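(* Let $\mathfrak{g}$ be a $5$-dimensional contact Calabi-Yau Lie algebra. Then $\mathfrak{g}$ is isomorphic, as a Lie algebra, to the Heisenberg Lie algebra $\mathfrak{h}_5$.
   Context: All Lie algebras are real; $d$ is the Chevalley–Eilenberg differential, so $d\eta(X,Y)=-\eta([X,Y])$ for a $1$-form $\eta$. An almost contact metric Lie algebra $(\mathfrak{g},\varphi,\xi,\eta,g)$ is an odd-dimensional Lie algebra $\mathfrak{g}$ with $\varphi\in\mathrm{End}(\mathfrak{g})$, $\xi\in\mathfrak{g}$, $\eta\in\mathfrak{g}^*$ and a positive-definite inner product $g$ such that $\varphi^2=-I+\eta\otimes\xi$, $\eta(\xi)=1$, $g(\varphi X,\varphi Y)=g(X,Y)-\eta(X)\eta(Y)$. Its fundamental $2$-form is $\Phi(X,Y)=g(X,\varphi Y)$, and $$N_\varphi(X,Y)=[\varphi X,\varphi Y]+\varphi^2[X,Y]-\varphi[X,\varphi Y]-\varphi[\varphi X,Y]+d\eta(X,Y)\xi .$$ The structure is Sasakian if $N_\varphi=0$ and $d\eta=2\Phi$. A $5$-dimensional Lie algebra $\mathfrak{g}$ is contact Calabi-Yau if it is endowed with a Sasakian structure $(\varphi,\xi,\eta,g)$ and a non-vanishing complex form $\epsilon$ of type $(2,0)$ on $\ker\eta$ (with respect to the complex structure $\varphi|_{\ker\eta}$) which is basic, i.e. $\iota_\xi\epsilon=0$ and $\mathcal{L}_\xi\epsilon=0$ (that is, $\epsilon([\xi,X],Y)+\epsilon(X,[\xi,Y])=0$ for all $X,Y$), and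 satisfies $d\epsilon=0$ and $\epsilon\wedge\bar\epsilon=\frac12(d\eta)^2$. $\mathfrak{h}_5$ is the $5$-dimensional Heisenberg Lie algebra: it has a basis $e_1,\dots,e_5$ whose dual basis satisfies $de^1=de^2=de^3=de^4=0$, $de^5=e^1\wedge e^2+e^3\wedge e^4$. *)

theory Defs
  imports "HOL-Analysis.Analysis"
begin

section \<open>Real Lie algebras\<close>

text \<open>The underlying vector space is a whole type; the dimension is expressed by
  \<^term>\<open>dim (UNIV :: 'a::real_vector set)\<close>, which is \<open>0\<close> when there is no finite basis, so an odd
  or a nonzero value of it entails finite dimension.\<close>

locale lie_algebra =
  fixes br :: "'a::real_vector \<Rightarrow> 'a \<Rightarrow> 'a"
  assumes br_bilinear: "bilinear br"
    and br_alternating: "br X X = 0"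
    and br_jacobi: "br X (br Y Z) + br Y (br Z X) + br Z (br X Y) = 0"

definition lie_isomorphic ::
    "('a::real_vector \<Rightarrow> 'a \<Rightarrow> 'a) \<Rightarrow> ('b::real_vector \<Rightarrow> 'b \<Rightarrow> 'b) \<Rightarrow> bool" where
  "lie_isomorphic br br' \<longleftrightarrow>
     (\<exists>f. linear f \<and> bij f \<and> (\<forall>X Y. f (br X Y) = br' (f X) (f Y)))"


section \<open>Forms on a Lie algebra\<close>

text \<open>Forms are functions of their vector arguments, with real or complex values. Wedge products
  are normalised without factorials (sums over shuffles), so that
  \<open>(\<alpha> \<and> \<beta>)(X, Y) = \<alpha>(X) \<beta>(Y) - \<alpha>(Y) \<beta>(X)\<close> for 1-forms.\<close>

definition two_form :: "('a::real_vector \<Rightarrow> 'a \<Rightarrow> 'b::real_vector) \<Rightarrow> bool" where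
  "two_form \<omega> \<longleftrightarrow> bilinear \<omega> \<and> (\<forall>X. \<omega> X X = 0)"

definition ce_diff1 ::
    "('a \<Rightarrow> 'a \<Rightarrow> 'a) \<Rightarrow> ('a \<Rightarrow> 'b::real_vector) \<Rightarrow> 'a \<Rightarrow> 'a \<Rightarrow> 'b" where
  "ce_diff1 br \<alpha> X Y = - \<alpha> (br X Y)"

definition ce_diff2 ::
    "('a \<Rightarrow> 'a \<Rightarrow> 'a) \<Rightarrow> ('a \<Rightarrow> 'a \<Rightarrow> 'b::real_vector) \<Rightarrow> 'a \<Rightarrow> 'a \<Rightarrow> 'a \<Rightarrow> 'b" where
  "ce_diff2 br \<omega> X Y Z = - \<omega> (br X Y) Z + \<omega> (br X Z) Y - \<omega> (br Y Z) X"

definition lie_deriv2 ::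
    "('a \<Rightarrow> 'a \<Rightarrow> 'a) \<Rightarrow> 'a \<Rightarrow> ('a \<Rightarrow> 'a \<Rightarrow> 'b::real_vector) \<Rightarrow> 'a \<Rightarrow> 'a \<Rightarrow> 'b" where
  "lie_deriv2 br V \<omega> X Y = - (\<omega> (br V X) Y + \<omega> X (br V Y))"

definition wedge11 :: "('a \<Rightarrow> 'b::comm_ring_1) \<Rightarrow> ('a \<Rightarrow> 'b) \<Rightarrow> 'a \<Rightarrow> 'a \<Rightarrow> 'b" where
  "wedge11 \<alpha> \<beta> X Y = \<alpha> X * \<beta> Y - \<alpha> Y * \<beta> X"

definition wedge22 ::
    "('a \<Rightarrow> 'a \<Rightarrow> 'b::comm_ring_1) \<Rightarrow> ('a \<Rightarrow> 'a \<Rightarrow> 'b) \<Rightarrow> 'a \<Rightarrow> 'a \<Rightarrow> 'a \<Rightarrow> 'a \<Rightarrow> 'b" where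
  "wedge22 \<alpha> \<beta> X Y Z W =
     \<alpha> X Y * \<beta> Z W - \<alpha> X Z * \<beta> Y W + \<alpha> X W * \<beta> Y Z
     + \<alpha> Y Z * \<beta> X W - \<alpha> Y W * \<beta> X Z + \<alpha> Z W * \<beta> X Y"


section \<open>Sasakian and contact Calabi-Yau structures\<close>

definition pos_def_inner :: "('a::real_vector \<Rightarrow> 'a \<Rightarrow> real) \<Rightarrow> bool" where
  "pos_def_inner g \<longleftrightarrow>
     bilinear g \<and> (\<forall>X Y. g X Y = g Y X) \<and> (\<forall>X. X \<noteq> 0 \<longrightarrow> g X X > 0)"

locale almost_contact_metric_lie_algebra = lie_algebra br
  for br :: "'a::real_vector \<Rightarrow> 'a \<Rightarrow> 'a" +
  fixes \<phi> :: "'a \<Rightarrow> 'a" and \<xi> :: 'a and \<eta> :: "'a \<Rightarrow> real" and g :: "'a \<Rightarrow> 'a \<Rightarrow> real"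
  assumes odd_dim: "odd (dim (UNIV :: 'a set))"
    and phi_linear: "linear \<phi>"
    and eta_linear: "linear \<eta>"
    and g_inner: "pos_def_inner g"
    and phi_sq: "\<phi> (\<phi> X) = - X + \<eta> X *\<^sub>R \<xi>"
    and eta_xi: "\<eta> \<xi> = 1"
    and g_compat: "g (\<phi> X) (\<phi> Y) = g X Y - \<eta> X * \<eta> Y"

definition fundamental_form :: "('a \<Rightarrow> 'a) \<Rightarrow> ('a \<Rightarrow> 'a \<Rightarrow> real) \<Rightarrow> 'a \<Rightarrow> 'a \<Rightarrow> real" where
  "fundamental_form \<phi> g X Y = g X (\<phi> Y)"

definition nijenhuis_contact ::
    "('a::real_vector \<Rightarrow> 'a \<Rightarrow> 'a) \<Rightarrow> ('a \<Rightarrow> 'a) \<Rightarrow> 'a \<Rightarrow> ('a \<Rightarrow> real) \<Rightarrow> 'a \<Rightarrow> 'a \<Rightarrow> 'a" where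
  "nijenhuis_contact br \<phi> \<xi> \<eta> X Y =
     br (\<phi> X) (\<phi> Y) + \<phi> (\<phi> (br X Y)) - \<phi> (br X (\<phi> Y)) - \<phi> (br (\<phi> X) Y)
     + ce_diff1 br \<eta> X Y *\<^sub>R \<xi>"

locale sasakian_lie_algebra = almost_contact_metric_lie_algebra br \<phi> \<xi> \<eta> g
  for br :: "'a::real_vector \<Rightarrow> 'a \<Rightarrow> 'a" and \<phi> \<xi> \<eta> g +
  assumes normal: "nijenhuis_contact br \<phi> \<xi> \<eta> X Y = 0"
    and contact_metric: "ce_diff1 br \<eta> X Y = 2 * fundamental_form \<phi> g X Y"

text \<open>A complex form on \<open>ker \<eta>\<close> has type (2,0) with respect to \<open>J = \<phi>|ker \<eta>\<close> if its complex
  bilinear extension to the complexification of \<open>ker \<eta>\<close> vanishes as soon as one argument is a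
  (0,1)-vector, i.e. one of the form \<open>X + \<i> J X\<close>. By skew symmetry and complex bilinearity it is
  enough to ask this for the first argument and a real second one.\<close>

definition type_2_0 ::
    "('a \<Rightarrow> 'a) \<Rightarrow> ('a \<Rightarrow> real) \<Rightarrow> ('a \<Rightarrow> 'a \<Rightarrow> complex) \<Rightarrow> bool" where
  "type_2_0 \<phi> \<eta> \<epsilon> \<longleftrightarrow>
     (\<forall>X Y. \<eta> X = 0 \<longrightarrow> \<eta> Y = 0 \<longrightarrow> \<epsilon> X Y + \<i> * \<epsilon> (\<phi> X) Y = 0)"

definition basic2 ::
    "('a \<Rightarrow> 'a \<Rightarrow> 'a) \<Rightarrow> 'a \<Rightarrow> ('a \<Rightarrow> 'a \<Rightarrow> complex) \<Rightarrow> bool" where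
  "basic2 br \<xi> \<epsilon> \<longleftrightarrow> (\<forall>X. \<epsilon> \<xi> X = 0) \<and> (\<forall>X Y. lie_deriv2 br \<xi> \<epsilon> X Y = 0)"

locale contact_calabi_yau_structure = sasakian_lie_algebra br \<phi> \<xi> \<eta> g
  for br :: "'a::real_vector \<Rightarrow> 'a \<Rightarrow> 'a" and \<phi> \<xi> \<eta> g +
  fixes \<epsilon> :: "'a \<Rightarrow> 'a \<Rightarrow> complex"
  assumes dim_5: "dim (UNIV :: 'a set) = 5"
    and eps_two_form: "two_form \<epsilon>"
    and eps_nonvanishing: "\<exists>X Y. \<eta> X = 0 \<and> \<eta> Y = 0 \<and> \<epsilon> X Y \<noteq> 0"
    and eps_type: "type_2_0 \<phi> \<eta> \<epsilon>"
    and eps_basic: "basic2 br \<xi> \<epsilon>"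
    and eps_closed: "ce_diff2 br \<epsilon> X Y Z = 0"
    and eps_volume:
      "wedge22 \<epsilon> (\<lambda>U V. cnj (\<epsilon> U V)) X Y Z W =
         complex_of_real (1/2 * wedge22 (ce_diff1 br \<eta>) (ce_diff1 br \<eta>) X Y Z W)"

definition contact_calabi_yau :: "('a::real_vector \<Rightarrow> 'a \<Rightarrow> 'a) \<Rightarrow> bool" where
  "contact_calabi_yau br \<longleftrightarrow> (\<exists>\<phi> \<xi> \<eta> g \<epsilon>. contact_calabi_yau_structure br \<phi> \<xi> \<eta> g \<epsilon>)"


section \<open>The Heisenberg Lie algebra\<close>

text \<open>With \<open>d\<eta>(X,Y) = -\<eta>([X,Y])\<close>, the equation \<open>de\<^sup>5 = e\<^sup>1 \<and> e\<^sup>2 + e\<^sup>3 \<and> e\<^sup>4\<close> makes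
  \<open>[e\<^sub>1,e\<^sub>2] = [e\<^sub>3,e\<^sub>4] = -e\<^sub>5\<close> the nonzero brackets.\<close>

definition h5 :: "real^5 \<Rightarrow> real^5 \<Rightarrow> real^5" where
  "h5 X Y = - ((X$1 * Y$2 - X$2 * Y$1) + (X$3 * Y$4 - X$4 * Y$3)) *\<^sub>R axis 5 1"

lemma h5_structure_equations:
  "ce_diff1 h5 (\<lambda>X. X$1) = (\<lambda>X Y. 0)"
  "ce_diff1 h5 (\<lambda>X. X$2) = (\<lambda>X Y. 0)"
  "ce_diff1 h5 (\<lambda>X. X$3) = (\<lambda>X Y. 0)"
  "ce_diff1 h5 (\<lambda>X. X$4) = (\<lambda>X Y. 0)"
  "ce_diff1 h5 (\<lambda>X. X$5) =
     (\<lambda>X Y. wedge11 (\<lambda>X. X$1) (\<lambda>X. X$2) X Y + wedge11 (\<lambda>X. X$3) (\<lambda>X. X$4) X Y)"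
  by (auto simp: fun_eq_iff ce_diff1_def h5_def wedge11_def axis_def algebra_simps)

lemma h5_lie_algebra: "lie_algebra h5"
proof
  show "bilinear h5"
    unfolding bilinear_def h5_def
    by (auto intro!: linearI simp: algebra_simps vec_eq_iff)
qed (simp_all add: h5_def axis_def)

end

theory Submission
  imports Defs
begin

text \<open>On the transverse space \<open>ker \<eta>\<close>, the forms \<open>d\<eta>\<close>, \<open>Re \<epsilon>\<close> and \<open>Im \<epsilon>\<close> are, up to
  real and complex scaling of \<open>d\<eta>\<close> and \<open>\<epsilon>\<close>, the Kaehler forms of a quaternionic structure, and all three are closed. A frame
  adapted to \<open>\<phi>\<close> identifies \<open>ker \<eta>\<close> with the quaternions, the complex structures acting by left
  multiplication. Closedness forces the transverse bracket to be \<open>F x y = y \<cdot> a x - x \<cdot> a y\<close> with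
  \<open>a\<close> linear and purely imaginary (right multiplication by \<open>a x\<close> is the transverse Levi-Civita
  connection), and invariance of the three forms makes \<open>D = ad \<xi>\<close> the right multiplication by an imaginary \<open>c\<close>.

  If \<open>c \<noteq> 0\<close> then \<open>D\<^sup>2\<close> is a nonzero multiple of the identity; as \<open>D\<close> is a derivation, comparing
  eigenvalues gives \<open>F = 0\<close>, which contradicts the Jacobi identity since \<open>d\<eta> \<noteq> 0\<close>. So \<open>\<xi>\<close> is central and
  \<open>F\<close> satisfies the Jacobi identity. For dimension reasons \<open>a\<close> has a kernel; after a right translation
  \<open>a 1 = 0\<close>, and then \<open>a\<close> is given by a 3 x 3 matrix \<open>A\<close>. Two contractions of the Jacobi identity read
  \<open>|A|\<^sup>2 = tr A\<^sup>2\<close> and \<open>|A|\<^sup>2 = - tr A\<^sup>2\<close>, so \<open>a = 0\<close>. Hence \<open>d\<eta>\<close> alone determines the bracket.\<close>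

section \<open>Quaternions\<close>

text \<open>Hamilton's product, with \<open>axis 1 1\<close>, ..., \<open>axis 4 1\<close> as 1, i,
  j, k.\<close>

definition qmul :: "real^4 \<Rightarrow> real^4 \<Rightarrow> real^4" (infixl "\<odot>" 70) where
  "x \<odot> y = (\<chi> k. if k = 1 then x$1*y$1 - x$2*y$2 - x$3*y$3 - x$4*y$4
              else if k = 2 then x$1*y$2 + x$2*y$1 + x$3*y$4 - x$4*y$3
              else if k = 3 then x$1*y$3 - x$2*y$4 + x$3*y$1 + x$4*y$2
              else x$1*y$4 + x$2*y$3 - x$3*y$2 + x$4*y$1)"

lemma qmul_nth:
  "(x \<odot> y)$1 = x$1*y$1 - x$2*y$2 - x$3*y$3 - x$4*y$4"
  "(x \<odot> y)$2 = x$1*y$2 + x$2*y$1 + x$3*y$4 - x$4*y$3"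
  "(x \<odot> y)$3 = x$1*y$3 - x$2*y$4 + x$3*y$1 + x$4*y$2"
  "(x \<odot> y)$4 = x$1*y$4 + x$2*y$3 - x$3*y$2 + x$4*y$1"
  by (simp_all add: qmul_def)

lemma axis4_nth: "(axis k c :: real^4) $ l = (if l = k then c else 0)"
  by (simp add: axis_def)

lemma inner4: "(x :: real^4) \<bullet> y = x$1*y$1 + x$2*y$2 + x$3*y$3 + x$4*y$4"
  by (simp add: inner_vec_def sum_4)

lemma qmul_assoc: "x \<odot> y \<odot> z = x \<odot> (y \<odot> z)"
  by (simp add: vec_eq_iff forall_4 qmul_nth algebra_simps)

lemma bilinear_qmul: "bilinear (\<odot>)"
  unfolding bilinear_def
  by (auto intro!: linearI simp: vec_eq_iff forall_4 qmul_nth algebra_simps)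

lemmas qmul_linear_simps =
  bilinear_ladd[OF bilinear_qmul] bilinear_radd[OF bilinear_qmul]
  bilinear_lsub[OF bilinear_qmul] bilinear_rsub[OF bilinear_qmul]
  bilinear_lmul[OF bilinear_qmul] bilinear_rmul[OF bilinear_qmul]
  bilinear_lzero[OF bilinear_qmul] bilinear_rzero[OF bilinear_qmul]

lemma qmul_one: "axis 1 1 \<odot> x = x" "x \<odot> axis 1 1 = x"
  by (simp_all add: vec_eq_iff forall_4 qmul_nth axis4_nth)

lemma qmul_imag_sq:
  assumes "c$1 = 0"
  shows "x \<odot> c \<odot> c = - (c \<bullet> c) *\<^sub>R x"
  using assms by (simp add: vec_eq_iff forall_4 qmul_nth inner4 algebra_simps)

lemma qmul_inverse:
  assumes "u \<noteq> 0"
  obtains v where "u \<odot> v = axis 1 1" "v \<odot> u = axis 1 1"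
proof
  define n where "n = inverse (u \<bullet> u)"
  have n: "n * (u$1*u$1 + u$2*u$2 + u$3*u$3 + u$4*u$4) = 1"
    using assms by (simp add: n_def flip: inner4)
  define v where "v = n *\<^sub>R (\<chi> k. if k = 1 then u$1 else - u$k)"
  have v: "v$1 = n * u$1" "v$2 = - n*u$2" "v$3 = - n*u$3" "v$4 = - n*u$4"
    by (simp_all add: v_def)
  show "u \<odot> v = axis 1 1" "v \<odot> u = axis 1 1"
    using n by (simp_all add: vec_eq_iff forall_4 qmul_nth axis4_nth v algebra_simps)
qed

text \<open>For \<open>k = 2, 3, 4\<close> these are the Kaehler forms of left multiplication by the units i, j, k.\<close>

definition qform :: "4 \<Rightarrow> real^4 \<Rightarrow> real^4 \<Rightarrow> real" where
  "qform k x y = (axis k 1 \<odot> x) \<bullet> y"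

lemma qform_simps:
  "qform 2 x y = x$1*y$2 - x$2*y$1 + x$3*y$4 - x$4*y$3"
  "qform 3 x y = x$1*y$3 - x$3*y$1 + x$4*y$2 - x$2*y$4"
  "qform 4 x y = x$1*y$4 - x$4*y$1 + x$2*y$3 - x$3*y$2"
  by (simp_all add: qform_def inner4 qmul_nth axis4_nth algebra_simps)

text \<open>An infinitesimal symmetry of all three forms commutes with their quotients, which up to
  sign are the left multiplications by i, j, k. Hence it is right multiplication by its value at 1,
  and skewness makes that value imaginary. The proof solves the linear equations on pairs of basis
  vectors.\<close>

lemma qform_skew_right_mult:
  assumes D: "linear D"
    and skew: "\<And>k x y. k \<in> {2,3,4} \<Longrightarrow> qform k (D x) y + qform k x (D y) = 0"
  shows "D x = x \<odot> D (axis 1 1)" "D (axis 1 1) $ 1 = 0"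
proof -
  have eqs:
    "qform 2 (D (axis i 1)) (axis j 1) + qform 2 (axis i 1) (D (axis j 1)) = 0"
    "qform 3 (D (axis i 1)) (axis j 1) + qform 3 (axis i 1) (D (axis j 1)) = 0"
    "qform 4 (D (axis i 1)) (axis j 1) + qform 4 (axis i 1) (D (axis j 1)) = 0" for i j
    by (simp_all add: skew)
  note E = eqs[of 1 2] eqs[of 1 3] eqs[of 1 4] eqs[of 2 3] eqs[of 2 4] eqs[of 3 4]
  note E' = E[unfolded qform_simps, simplified axis4_nth, simplified]
  show one: "D (axis 1 1) $ 1 = 0"
    \<comment> \<open>The first three diagonal entries of \<open>D\<close> sum pairwise to
      0.\<close>
    using E'(1,5,12) by linarith
  have lin: "linear (\<lambda>x. x \<odot> D (axis 1 1))"
    using bilinear_qmul by (simp add: bilinear_def)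
  have "D (axis 2 1) $ 1 = - D (axis 1 1) $ 2" "D (axis 2 1) $ 2 = 0"
    "D (axis 2 1) $ 3 = - D (axis 1 1) $ 4" "D (axis 2 1) $ 4 = D (axis 1 1) $ 3"
    "D (axis 3 1) $ 1 = - D (axis 1 1) $ 3" "D (axis 3 1) $ 2 = D (axis 1 1) $ 4"
    "D (axis 3 1) $ 3 = 0" "D (axis 3 1) $ 4 = - D (axis 1 1) $ 2"
    "D (axis 4 1) $ 1 = - D (axis 1 1) $ 4" "D (axis 4 1) $ 2 = - D (axis 1 1) $ 3"
    "D (axis 4 1) $ 3 = D (axis 1 1) $ 2" "D (axis 4 1) $ 4 = 0"
    using one E'(1-3,5-11,13) E'(4,9) by simp_all
  then have "\<forall>i. D (axis i 1) = axis i 1 \<odot> D (axis 1 1)"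
    by (simp add: forall_4 vec_eq_iff qmul_nth axis4_nth one)
  then have ax: "D (axis i 1) = axis i 1 \<odot> D (axis 1 1)" for i
    by blast
  have "D = (\<lambda>x. x \<odot> D (axis 1 1))"
    by (rule linear_eq_stdbasis[OF D lin]) (auto simp: Basis_vec_def intro: ax)
  then show "D x = x \<odot> D (axis 1 1)" by metis
qed


section \<open>Hyperkaehler Lie algebras of dimension four\<close>

lemma bilinear_eq_on_axes:
  fixes F G :: "real^4 \<Rightarrow> real^4 \<Rightarrow> 'b::real_vector"
  assumes "bilinear F" "bilinear G" "\<And>i j. F (axis i 1) (axis j 1) = G (axis i 1) (axis j 1)"
  shows "F = G"
  by (rule bilinear_eq_stdbasis[OF assms(1,2)]) (auto simp: Basis_vec_def intro: assms(3))

text \<open>Closedness of the three forms amounts to twelve independent equations for the 24 structure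
  constants; the remaining twelve parameters are the entries of \<open>a\<close>.\<close>

lemma closed_bracket_form:
  assumes F: "bilinear F" "\<And>x. F x x = 0"
    and closed: "\<And>k x y z. k \<in> {2,3,4} \<Longrightarrow> ce_diff2 F (qform k) x y z = 0"
  obtains a where "linear a" "\<And>x. a x $ 1 = 0" "\<And>x y. F x y = y \<odot> a x - x \<odot> a y"
proof -
  define c where "c i j k = F (axis i 1) (axis j 1) $ k" for i j k
  have skew: "F x y = - F y x" for x y
    using F(2)[of "x + y"]
    by (simp add: bilinear_ladd[OF F(1)] bilinear_radd[OF F(1)] F(2)[of x] F(2)[of y]
        eq_neg_iff_add_eq_0 add.commute)
  have d:
    "ce_diff2 F (qform 2) (axis i 1) (axis j 1) (axis l 1) = 0"
    "ce_diff2 F (qform 3) (axis i 1) (axis j 1) (axis l 1) = 0"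
    "ce_diff2 F (qform 4) (axis i 1) (axis j 1) (axis l 1) = 0" for i j l
    by (simp_all add: closed)
  note d = d[of 1 2 3] d[of 1 2 4] d[of 1 3 4] d[of 2 3 4]
  note E = d[unfolded ce_diff2_def qform_simps axis4_nth, simplified, folded c_def]
  \<comment> \<open>Each entry is read off from a component of
    \<open>F x y = y \<odot> a x - x \<odot> a y\<close> on basis vectors in which only that entry
    of \<open>a\<close> survives. The other twelve components will follow from
    \<open>E\<close>.\<close>
  define A :: "4 \<Rightarrow> real^4" where
    "A i = (if i = 1 then vector [0, - c 1 2 1, - c 1 3 1, - c 1 4 1]
            else if i = 2 then vector [0, - c 1 2 2, - c 2 4 2, c 2 3 2]
            else if i = 3 then vector [0, c 3 4 3, - c 1 3 3, c 2 3 3]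
            else vector [0, c 3 4 4, - c 2 4 4, - c 1 4 4])" for i
  define a where "a x = (\<Sum>i\<in>UNIV. x$i *\<^sub>R A i)" for x :: "real^4"
  have A: "A i $ 1 = 0"
    "A 1 $ 2 = - c 1 2 1" "A 1 $ 3 = - c 1 3 1" "A 1 $ 4 = - c 1 4 1"
    "A 2 $ 2 = - c 1 2 2" "A 2 $ 3 = - c 2 4 2" "A 2 $ 4 = c 2 3 2"
    "A 3 $ 2 = c 3 4 3" "A 3 $ 3 = - c 1 3 3" "A 3 $ 4 = c 2 3 3"
    "A 4 $ 2 = c 3 4 4" "A 4 $ 3 = - c 2 4 4" "A 4 $ 4 = - c 1 4 4" for i
    by (simp_all add: A_def vector_def)
  have lin: "linear a"
    by (rule linearI) (simp_all add: a_def sum_4 algebra_simps)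
  have a_axis: "a (axis i 1) = A i" for i
    using exhaust_4[of i] by (auto simp: a_def sum_4 axis4_nth)
  define G where "G x y = y \<odot> a x - x \<odot> a y" for x y
  have G: "bilinear G"
    using lin unfolding bilinear_def G_def
    by (auto intro!: linearI simp: linear_add linear_cmul qmul_linear_simps algebra_simps)
  have GF: "F (axis 1 1) (axis 2 1) = G (axis 1 1) (axis 2 1)"
    "F (axis 1 1) (axis 3 1) = G (axis 1 1) (axis 3 1)"
    "F (axis 1 1) (axis 4 1) = G (axis 1 1) (axis 4 1)"
    "F (axis 2 1) (axis 3 1) = G (axis 2 1) (axis 3 1)"
    "F (axis 2 1) (axis 4 1) = G (axis 2 1) (axis 4 1)"
    "F (axis 3 1) (axis 4 1) = G (axis 3 1) (axis 4 1)"
    using E by (simp_all add: vec_eq_iff forall_4 G_def a_axis qmul_nth axis4_nth A flip: c_def)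
  have GF': "F (axis j 1) (axis i 1) = G (axis j 1) (axis i 1)"
    if "F (axis i 1) (axis j 1) = G (axis i 1) (axis j 1)" for i j
    using that skew[of "axis j 1" "axis i 1"] by (simp add: G_def)
  have "\<forall>i j. F (axis i 1) (axis j 1) = G (axis i 1) (axis j 1)"
    by (simp only: forall_4 GF GF[THEN GF'] F(2)) (simp add: G_def)
  then have "F = G"
    by (intro bilinear_eq_on_axes F(1) G) blast
  then show ?thesis
    using that[OF lin] by (simp add: G_def a_def sum_4 A)
qed

text \<open>The Jacobi identity is quadratic in \<open>a\<close>, and a few of its components
  combine to a vanishing sum of squares of the entries.\<close>

lemma quaternionic_jacobi_imp_zero:
  fixes a :: "real^4 \<Rightarrow> real^4"
  defines "F \<equiv> \<lambda>x y. y \<odot> a x - x \<odot> a y"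
  assumes a: "linear a" "\<And>x. a x $ 1 = 0" "a (axis 1 1) = 0"
    and jacobi: "\<And>x y z. F x (F y z) + F y (F z x) + F z (F x y) = 0"
  shows "a x = 0"
proof -
  define A where "A i j = a (axis i 1) $ j" for i j
  have a_nth: "a z $ j = z$2 * A 2 j + z$3 * A 3 j + z$4 * A 4 j" for z j
  proof -
    have "z = z$1 *\<^sub>R axis 1 1 + z$2 *\<^sub>R axis 2 1 + z$3 *\<^sub>R axis 3 1 + z$4 *\<^sub>R axis 4 1"
      by (simp add: vec_eq_iff forall_4 axis4_nth)
    then have "a z = z$1 *\<^sub>R a (axis 1 1) + z$2 *\<^sub>R a (axis 2 1) + z$3 *\<^sub>R a (axis 3 1)
        + z$4 *\<^sub>R a (axis 4 1)"
      by (metis linear_add[OF a(1)] linear_cmul[OF a(1)])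
    then show ?thesis
      by (simp add: A_def a(3))
  qed
  have A: "A j 1 = 0" for j
    by (simp add: A_def a(2))
  have jac: "(F x (F y z) + F y (F z x) + F z (F x y)) $ k = 0" for x y z k
    using jacobi[of x y z] by simp
  \<comment> \<open>Real part of the Jacobi identity on i, j, k; the diagonal has cancelled, and
    what is left says that \<open>A\<close> is symmetric.\<close>
  have "A 2 3 * A 2 3 + A 3 2 * A 3 2 + A 2 4 * A 2 4 + A 4 2 * A 4 2 + A 3 4 * A 3 4 + A 4 3 * A 4 3
      = 2 * (A 2 3 * A 3 2 + A 2 4 * A 4 2 + A 3 4 * A 4 3)"
    using jac[of "axis 2 1" "axis 3 1" "axis 4 1" 1]
    by (simp add: F_def qmul_nth a_nth A axis4_nth algebra_simps)
  \<comment> \<open>The i, j and k components of the Jacobi identity on 1 and the two other units,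
    added up as a trace.\<close>
  moreover have "A 2 2 * A 2 2 + A 2 3 * A 2 3 + A 2 4 * A 2 4
     + A 3 2 * A 3 2 + A 3 3 * A 3 3 + A 3 4 * A 3 4
     + A 4 2 * A 4 2 + A 4 3 * A 4 3 + A 4 4 * A 4 4
     + (A 2 2 * A 2 2 + A 3 3 * A 3 3 + A 4 4 * A 4 4
      + 2 * (A 2 3 * A 3 2 + A 2 4 * A 4 2 + A 3 4 * A 4 3)) = 0"
    using jac[of "axis 1 1" "axis 3 1" "axis 4 1" 2] jac[of "axis 1 1" "axis 4 1" "axis 2 1" 3]
      jac[of "axis 1 1" "axis 2 1" "axis 3 1" 4]
    by (simp add: F_def qmul_nth a_nth A axis4_nth algebra_simps)
  ultimately have "(A 2 2)\<^sup>2 + (A 2 3)\<^sup>2 + (A 2 4)\<^sup>2 + (A 3 2)\<^sup>2 + (A 3 3)\<^sup>2 + (A 3 4)\<^sup>2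
     + (A 4 2)\<^sup>2 + (A 4 3)\<^sup>2 + (A 4 4)\<^sup>2 = 0"
    by (simp add: power2_eq_square)
  then have "A 2 2 = 0 \<and> A 2 3 = 0 \<and> A 2 4 = 0 \<and> A 3 2 = 0 \<and> A 3 3 = 0 \<and> A 3 4 = 0
     \<and> A 4 2 = 0 \<and> A 4 3 = 0 \<and> A 4 4 = 0"
    by (simp add: add_nonneg_eq_0_iff)
  then show ?thesis
    by (simp add: vec_eq_iff forall_4 a_nth A)
qed

text \<open>Since \<open>a\<close> takes only imaginary values, it is not onto and has a kernel
  vector, which a right multiplication moves to 1.\<close>

lemma hyperkaehler_abelian:
  assumes F: "bilinear F" "\<And>x. F x x = 0"
    and closed: "\<And>k x y z. k \<in> {2,3,4} \<Longrightarrow> ce_diff2 F (qform k) x y z = 0"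
    and jacobi: "\<And>x y z. F x (F y z) + F y (F z x) + F z (F x y) = 0"
  shows "F x y = 0"
proof -
  obtain a where a: "linear a" "\<And>x. a x $ 1 = 0" and Fa: "\<And>x y. F x y = y \<odot> a x - x \<odot> a y"
    using closed_bracket_form[OF F closed] by blast
  have "axis 1 1 \<notin> range a"
    using a(2) by (metis axis4_nth imageE zero_neq_one)
  then have "\<not> inj a"
    using linear_inj_imp_surj[OF a(1)] by blast
  then obtain u where u: "u \<noteq> 0" "a u = 0"
    using linear_injective_0[OF a(1)] by blast
  obtain v where v: "u \<odot> v = axis 1 1" "v \<odot> u = axis 1 1"
    using qmul_inverse[OF u(1)] .
  have uv: "x \<odot> u \<odot> v = x" "x \<odot> v \<odot> u = x" for x
    by (simp_all add: qmul_assoc v qmul_one)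
  \<comment> \<open>\<open>b\<close> belongs to the bracket transported along \<open>x \<mapsto> x \<odot> u\<close>; right multiplication commutes with the
    complex structures, so the transported bracket has the same shape.\<close>
  define b where "b x = u \<odot> a (x \<odot> u) \<odot> v" for x
  have G: "y \<odot> b x - x \<odot> b y = F (x \<odot> u) (y \<odot> u) \<odot> v" for x y
    by (simp add: Fa b_def qmul_linear_simps qmul_assoc)
  have "linear b"
    by (rule linearI) (simp_all add: b_def qmul_linear_simps linear_add[OF a(1)] linear_cmul[OF a(1)])
  moreover have "b x $ 1 = 0" for x
  proof -
    \<comment> \<open>The real part of a product does not depend on the order of its two
      factors.\<close>
    have "b x $ 1 = (a (x \<odot> u) \<odot> v \<odot> u) $ 1"
      unfolding b_def qmul_assoc by (simp only: qmul_nth) (simp add: algebra_simps)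
    then show ?thesis
      by (simp add: uv a(2))
  qed
  moreover have "b (axis 1 1) = 0"
    by (simp add: b_def qmul_one u qmul_linear_simps)
  moreover have "(z \<odot> b y - y \<odot> b z) \<odot> b x - x \<odot> b (z \<odot> b y - y \<odot> b z) +
        ((x \<odot> b z - z \<odot> b x) \<odot> b y - y \<odot> b (x \<odot> b z - z \<odot> b x)) +
        ((y \<odot> b x - x \<odot> b y) \<odot> b z - z \<odot> b (y \<odot> b x - x \<odot> b y)) = 0" for x y z
    using jacobi[of "x \<odot> u" "y \<odot> u" "z \<odot> u"]
    by (simp add: G uv qmul_linear_simps(7) flip: qmul_linear_simps(1))
  ultimately have "b x = 0" for x
    by (rule quaternionic_jacobi_imp_zero)
  then have "a x = 0" for x
    by (metis uv b_def qmul_assoc qmul_linear_simps(7,8) qmul_one(1) v)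
  then show ?thesis
    by (simp add: Fa qmul_linear_simps)
qed

text \<open>Here \<open>D\<close> stands for ad \<xi> on ker \<eta>. The right side of
  \<open>jacobi\<close> comes from the \<xi>-components of the brackets, on which ad \<xi>
  enters.\<close>

lemma reeb_action_zero:
  assumes F: "bilinear F" "\<And>x. F x x = 0"
    and D: "linear D" and skew: "\<And>k x y. k \<in> {2,3,4} \<Longrightarrow> qform k (D x) y + qform k x (D y) = 0"
    and derivation: "\<And>x y. D (F x y) = F (D x) y + F x (D y)"
    and jacobi: "\<And>x y z. F x (F y z) + F y (F z x) + F z (F x y)
      = 2 *\<^sub>R (qform 2 y z *\<^sub>R D x + qform 2 z x *\<^sub>R D y + qform 2 x y *\<^sub>R D z)"
  shows "D x = 0"
proof -
  define c where "c = D (axis 1 1)"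
  define s where "s = c \<bullet> c"
  have Dc: "D x = x \<odot> c" and c: "c$1 = 0" for x
    unfolding c_def using qform_skew_right_mult[OF D skew] by blast+
  have DD: "D (D x) = - s *\<^sub>R x" for x
    by (simp add: Dc qmul_imag_sq[OF c] s_def)
  have "s = 0"
  proof (rule ccontr)
    assume s: "s \<noteq> 0"
    note F_simps = bilinear_lneg[OF F(1)] bilinear_rneg[OF F(1)] bilinear_lmul[OF F(1)]
      bilinear_rmul[OF F(1)]
    \<comment> \<open>\<open>D\<^sup>2 = - s\<close> allows \<open>D\<close> only the eigenvalues \<open>\<plusminus> 2 \<i> sqrt s\<close> and 0 on brackets, whereas \<open>F\<close> takes its
      values in the eigenspaces of \<open>\<plusminus> \<i> sqrt s\<close>; \<open>half\<close> is the real form of this incompatibility.\<close>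
    have half: "F (D x) (D y) = (s / 2) *\<^sub>R F x y" for x y
    proof -
      have "- s *\<^sub>R F x y = D (D (F x y))"
        by (simp only: DD)
      also have "\<dots> = F (D (D x)) y + 2 *\<^sub>R F (D x) (D y) + F x (D (D y))"
        by (simp only: derivation linear_add[OF D] scaleR_2 add.assoc)
      also have "\<dots> = 2 *\<^sub>R F (D x) (D y) - (2 * s) *\<^sub>R F x y"
        by (simp only: DD F_simps) (simp add: algebra_simps flip: scaleR_2)
      finally have "2 *\<^sub>R F (D x) (D y) = (2 * s - s) *\<^sub>R F x y"
        by (simp only: scaleR_diff_left) (simp add: algebra_simps)
      then have "(1/2) *\<^sub>R 2 *\<^sub>R F (D x) (D y) = (1/2) *\<^sub>R (2 * s - s) *\<^sub>R F x y"
        by (simp only:)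
      then show ?thesis
        by simp
    qed
    have F0: "F x y = 0" for x y
    proof -
      \<comment> \<open>Applying \<open>half\<close> twice gives a quarter of what \<open>DD\<close>
        gives.\<close>
      have "(s * s) *\<^sub>R F x y = F (D (D x)) (D (D y))"
        by (simp only: DD F_simps) simp
      also have "\<dots> = (s / 2 * (s / 2)) *\<^sub>R F x y"
        by (simp only: half scaleR_scaleR)
      finally have "(s * s - s / 2 * (s / 2)) *\<^sub>R F x y = 0"
        by (simp only: scaleR_diff_left diff_self)
      then show ?thesis
        using s by simp
    qed
    \<comment> \<open>With \<open>F = 0\<close> the left side of \<open>jacobi\<close> vanishes, and
      on 1, i, j only one term remains on the right.\<close>
    have "D (axis 3 1) = 0"
      using jacobi[of "axis 1 1" "axis 2 1" "axis 3 1"]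
      by (simp add: F0 qform_simps axis4_nth)
    then show False
      using DD[of "axis 3 1"] s by (simp add: linear_0[OF D] axis_eq_0_iff)
  qed
  then show ?thesis
    by (simp add: s_def Dc qmul_linear_simps)
qed


section \<open>Adapted frames\<close>

context almost_contact_metric_lie_algebra
begin

lemma g_bilinear: "bilinear g" and g_sym: "g X Y = g Y X" and g_pos: "X \<noteq> 0 \<Longrightarrow> g X X > 0"
  using g_inner by (auto simp: pos_def_inner_def)

lemmas g_simps =
  bilinear_ladd[OF g_bilinear] bilinear_radd[OF g_bilinear]
  bilinear_lsub[OF g_bilinear] bilinear_rsub[OF g_bilinear]
  bilinear_lmul[OF g_bilinear] bilinear_rmul[OF g_bilinear]
  bilinear_lzero[OF g_bilinear] bilinear_rzero[OF g_bilinear]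
  bilinear_lneg[OF g_bilinear] bilinear_rneg[OF g_bilinear]

lemmas br_simps =
  bilinear_ladd[OF br_bilinear] bilinear_radd[OF br_bilinear]
  bilinear_lmul[OF br_bilinear] bilinear_rmul[OF br_bilinear]
  bilinear_lzero[OF br_bilinear] bilinear_rzero[OF br_bilinear]
  bilinear_lneg[OF br_bilinear] bilinear_rneg[OF br_bilinear]

lemmas eta_simps = linear_add[OF eta_linear] linear_diff[OF eta_linear] linear_cmul[OF eta_linear]
  linear_neg[OF eta_linear] linear_0[OF eta_linear]

lemmas phi_simps = linear_add[OF phi_linear] linear_diff[OF phi_linear] linear_cmul[OF phi_linear]
  linear_neg[OF phi_linear] linear_0[OF phi_linear]

lemma br_skew: "br X Y = - br Y X"
  using br_alternating[of "X + Y"]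
  by (simp add: br_simps br_alternating[of X] br_alternating[of Y] eq_neg_iff_add_eq_0 add.commute)

lemma xi_nonzero: "\<xi> \<noteq> 0"
  using eta_xi by (auto simp: eta_simps)

lemma phi_xi: "\<phi> \<xi> = 0"
proof -
  have 0: "\<phi> (\<phi> \<xi>) = 0"
    by (simp add: phi_sq eta_xi)
  then have 1: "\<phi> \<xi> = \<eta> (\<phi> \<xi>) *\<^sub>R \<xi>"
    using phi_sq[of "\<phi> \<xi>"] by (simp add: phi_simps)
  then have "\<phi> (\<phi> \<xi>) = \<eta> (\<phi> \<xi>) *\<^sub>R \<phi> \<xi>"
    by (metis linear_cmul[OF phi_linear])
  then have "\<eta> (\<phi> \<xi>) *\<^sub>R \<phi> \<xi> = 0"
    using 0 by simp
  then show ?thesis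
    using 1 by auto
qed

text \<open>Compare the two ways of reducing the cube of \<phi> by \<open>phi_sq\<close>.\<close>

lemma eta_phi: "\<eta> (\<phi> X) = 0"
proof -
  have "\<phi> (\<phi> (\<phi> X)) = - \<phi> X"
    by (simp add: phi_sq[of X] phi_simps phi_xi)
  then show ?thesis
    using phi_sq[of "\<phi> X"] xi_nonzero by simp
qed

lemma g_xi: "g X \<xi> = \<eta> X" "g \<xi> X = \<eta> X"
  using g_compat[of X \<xi>] g_sym[of \<xi> X] by (simp_all add: phi_xi eta_xi g_simps)

lemma g_phi_skew: "g (\<phi> X) Y = - g X (\<phi> Y)"
  using g_compat[of X "\<phi> Y"] by (simp add: eta_phi phi_sq g_simps g_xi)

lemma orthonormal_independent:
  assumes "finite S" "\<And>x y. x \<in> S \<Longrightarrow> y \<in> S \<Longrightarrow> g x y = (if x = y then 1 else 0)"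
  shows "independent S"
proof (rule independent_if_scalars_zero[OF assms(1)])
  fix f y assume f: "(\<Sum>x\<in>S. f x *\<^sub>R x) = 0" and y: "y \<in> S"
  have "linear (\<lambda>x. g x y)"
    using g_bilinear by (simp add: bilinear_def)
  then have "g (\<Sum>x\<in>S. f x *\<^sub>R x) y = (\<Sum>x\<in>S. f x * g x y)"
    by (subst linear_sum[where f = "\<lambda>x. g x y"]) (simp_all add: g_simps)
  also have "\<dots> = (\<Sum>x\<in>S. if x = y then f x else 0)"
    by (rule sum.cong) (simp_all add: assms(2) y)
  also have "\<dots> = f y"
    using assms(1) y by simp
  finally show "f y = 0"
    using f by (simp add: g_simps)
qed

lemma obtain_unit:
  assumes "X \<noteq> 0"
  obtains r where "g (r *\<^sub>R X) (r *\<^sub>R X) = 1"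
proof
  show "g ((1 / sqrt (g X X)) *\<^sub>R X) ((1 / sqrt (g X X)) *\<^sub>R X) = 1"
    using g_pos[OF assms] by (simp add: g_simps)
qed

lemma g_self_phi: "g X (\<phi> X) = 0"
  using g_phi_skew[of X X] g_sym[of X "\<phi> X"] by simp

definition adapted_frame :: "(4 \<Rightarrow> 'a) \<Rightarrow> bool" where
  "adapted_frame e \<longleftrightarrow> (\<forall>i j. g (e i) (e j) = (if i = j then 1 else 0)) \<and> (\<forall>i. \<eta> (e i) = 0)
     \<and> \<phi> (e 1) = e 2 \<and> \<phi> (e 3) = e 4"

text \<open>Gram-Schmidt in which every new unit vector, orthogonal to \<xi> and its predecessors,
  brings its \<phi>-image along.\<close>

lemma adapted_frame_exists:
  assumes dim: "dim (UNIV :: 'a set) = 5"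
  obtains e where "adapted_frame e"
proof -
  have outside: "\<exists>X. X \<notin> span S" if "finite S" "card S \<le> 3" for S :: "'a set"
  proof -
    have "\<not> UNIV \<subseteq> span S"
      using dim_le_card[of UNIV S] that dim by auto
    then show ?thesis
      by blast
  qed
  obtain X where X: "X \<notin> span {\<xi>}"
    using outside[of "{\<xi>}"] by auto
  define X' where "X' = X - \<eta> X *\<^sub>R \<xi>"
  have "X' \<noteq> 0"
    using X by (auto simp: X'_def span_singleton)
  then obtain r where r: "g (r *\<^sub>R X') (r *\<^sub>R X') = 1"
    by (rule obtain_unit)
  define e1 where "e1 = r *\<^sub>R X'"
  have e1: "g e1 e1 = 1" "\<eta> e1 = 0"
    using r by (simp_all add: e1_def X'_def eta_simps eta_xi)
  have e2: "g (\<phi> e1) (\<phi> e1) = 1"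
    by (simp add: g_compat e1)
  have "card {\<xi>, e1, \<phi> e1} \<le> 3"
    by (simp add: card_insert_if)
  then obtain Y where Y: "Y \<notin> span {\<xi>, e1, \<phi> e1}"
    using outside[of "{\<xi>, e1, \<phi> e1}"] by auto
  define Y' where "Y' = Y - (\<eta> Y *\<^sub>R \<xi> + g Y e1 *\<^sub>R e1 + g Y (\<phi> e1) *\<^sub>R \<phi> e1)"
  have "\<eta> Y *\<^sub>R \<xi> + g Y e1 *\<^sub>R e1 + g Y (\<phi> e1) *\<^sub>R \<phi> e1 \<in> span {\<xi>, e1, \<phi> e1}"
    by (intro span_add span_scale span_base) auto
  then have "Y' \<noteq> 0"
    using Y by (auto simp: Y'_def)
  then obtain s where s: "g (s *\<^sub>R Y') (s *\<^sub>R Y') = 1"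
    by (rule obtain_unit)
  define e3 where "e3 = s *\<^sub>R Y'"
  have e12: "g e1 (\<phi> e1) = 0" "g (\<phi> e1) e1 = 0"
    using g_self_phi g_sym by metis+
  have e3: "g e3 e3 = 1" "\<eta> e3 = 0" "g e3 e1 = 0" "g e3 (\<phi> e1) = 0"
    using s by (simp_all add: e3_def Y'_def eta_simps eta_xi eta_phi e1 e2 e12 g_simps g_xi)
  define e where "e i = (if i = 1 then e1 else if i = 2 then \<phi> e1 else if i = 3 then e3 else \<phi> e3)"
    for i :: 4
  have e4: "g (\<phi> e1) (\<phi> e3) = 0" "g e1 (\<phi> e3) = 0" "g e3 (\<phi> e3) = 0"
    using e3 g_sym[of e1 e3] g_phi_skew[of e1 e3] g_sym[of "\<phi> e1" e3]
    by (simp_all add: g_compat g_self_phi e1)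
  note gs = e1(1) e2 e12 e3(1,3,4) e4
  have "adapted_frame e"
    unfolding adapted_frame_def forall_4
    by (simp add: e_def gs gs[THEN trans[OF g_sym]] e1 e3 eta_phi g_compat)
  then show ?thesis ..
qed

lemma adapted_frame_expansion:
  assumes dim: "dim (UNIV :: 'a set) = 5" and e: "adapted_frame e"
  shows "X = (\<Sum>i\<in>UNIV. g X (e i) *\<^sub>R e i) + \<eta> X *\<^sub>R \<xi>"
proof -
  have ge: "g (e i) (e j) = (if i = j then 1 else 0)" and eta_e: "\<eta> (e i) = 0" for i j
    using e by (auto simp: adapted_frame_def)
  let ?S = "insert \<xi> (range e)"
  have inj: "inj e"
    by (rule injI) (metis ge zero_neq_one)
  have "\<xi> \<notin> range e"
    using eta_e eta_xi by (metis imageE zero_neq_one)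
  then have card: "card ?S = 5"
    using inj by (simp add: card_image)
  have indep: "independent ?S"
    by (rule orthonormal_independent) (use \<open>\<xi> \<notin> range e\<close> in \<open>auto simp: ge g_xi eta_e eta_xi inj_eq[OF inj]\<close>)
  have "X \<in> span ?S"
  proof (rule ccontr)
    assume X: "X \<notin> span ?S"
    obtain B where B: "(UNIV :: 'a set) \<subseteq> span B" "card B = 5"
      using basis_exists[of "UNIV :: 'a set"] dim by metis
    have "independent (insert X ?S)"
      by (rule independent_insertI[OF X indep])
    \<comment> \<open>\<open>B\<close> is finite, since an infinite set would have
      \<open>card\<close> 0.\<close>
    then have "card (insert X ?S) \<le> card B"
      using independent_span_bound[of B "insert X ?S"] B card.infinite by fastforce
    moreover have "card (insert X ?S) = 6"
      using X card span_base[of X ?S] by (subst card_insert_disjoint) auto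
    ultimately show False
      using B by simp
  qed
  moreover have "linear (\<lambda>X. (\<Sum>i\<in>UNIV. g X (e i) *\<^sub>R e i) + \<eta> X *\<^sub>R \<xi>)"
    by (rule linearI) (simp_all add: sum_4 g_simps eta_simps algebra_simps)
  moreover have "Y = (\<Sum>i\<in>UNIV. g Y (e i) *\<^sub>R e i) + \<eta> Y *\<^sub>R \<xi>" if "Y \<in> ?S" for Y
  proof (cases "Y = \<xi>")
    case True
    then show ?thesis
      by (simp add: g_xi eta_e eta_xi)
  next
    case False
    then obtain j where "Y = e j"
      using \<open>Y \<in> ?S\<close> by auto
    then show ?thesis
      using exhaust_4[of j] by (auto simp: sum_4 ge eta_e)
  qed
  ultimately show ?thesis
    using linear_eq_on[OF linear_id] by (metis (no_types, lifting) id_apply)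
qed

end


section \<open>The transverse bracket\<close>

context contact_calabi_yau_structure
begin

lemma eta_br: "\<eta> (br X Y) = - 2 * g X (\<phi> Y)"
  using contact_metric[of X Y] by (simp add: ce_diff1_def fundamental_form_def)

lemma eps_bilinear: "bilinear \<epsilon>" and eps_alternating: "\<epsilon> X X = 0"
  using eps_two_form by (auto simp: two_form_def)

lemmas eps_simps =
  bilinear_ladd[OF eps_bilinear] bilinear_radd[OF eps_bilinear]
  bilinear_lmul[OF eps_bilinear] bilinear_rmul[OF eps_bilinear]
  bilinear_lzero[OF eps_bilinear] bilinear_rzero[OF eps_bilinear]
  bilinear_lneg[OF eps_bilinear] bilinear_rneg[OF eps_bilinear]

lemma eps_skew: "\<epsilon> X Y = - \<epsilon> Y X"
  using eps_alternating[of "X + Y"]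
  by (simp add: eps_simps eps_alternating[of X] eps_alternating[of Y] eq_neg_iff_add_eq_0 add.commute)

lemma eps_xi: "\<epsilon> \<xi> X = 0" "\<epsilon> X \<xi> = 0"
  using eps_basic eps_skew[of X \<xi>] by (auto simp: basic2_def)

context
  fixes e :: "4 \<Rightarrow> 'a"
  assumes frame: "adapted_frame e"
begin

definition emb :: "real^4 \<Rightarrow> 'a" where
  "emb x = (\<Sum>i\<in>UNIV. x$i *\<^sub>R e i)"

definition coord :: "'a \<Rightarrow> real^4" where
  "coord X = (\<chi> i. g X (e i))"

text \<open>The bracket of ker \<eta> projected along \<xi>; its Jacobi identity holds only up to
  terms in \<open>reeb\<close>.\<close>

definition trans_br :: "real^4 \<Rightarrow> real^4 \<Rightarrow> real^4" where
  "trans_br x y = coord (br (emb x) (emb y))"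

definition reeb :: "real^4 \<Rightarrow> real^4" where
  "reeb x = coord (br \<xi> (emb x))"

lemma ge: "g (e i) (e j) = (if i = j then 1 else 0)" and eta_e: "\<eta> (e i) = 0"
  and phi_e: "\<phi> (e 1) = e 2" "\<phi> (e 2) = - e 1" "\<phi> (e 3) = e 4" "\<phi> (e 4) = - e 3"
proof -
  show *: "\<eta> (e i) = 0" "g (e i) (e j) = (if i = j then 1 else 0)" for i j
    using frame by (auto simp: adapted_frame_def)
  show "\<phi> (e 1) = e 2" "\<phi> (e 3) = e 4"
    using frame by (auto simp: adapted_frame_def)
  then show "\<phi> (e 2) = - e 1" "\<phi> (e 4) = - e 3"
    using phi_sq[of "e 1"] phi_sq[of "e 3"] by (simp_all add: *)
qed

lemma linear_emb: "linear emb"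
  by (rule linearI) (simp_all add: emb_def sum_4 algebra_simps)

lemmas emb_simps = linear_add[OF linear_emb] linear_cmul[OF linear_emb]
  linear_neg[OF linear_emb] linear_0[OF linear_emb]

lemma linear_coord: "linear coord"
  by (rule linearI) (simp_all add: coord_def vec_eq_iff g_simps)

lemmas coord_simps = linear_add[OF linear_coord] linear_diff[OF linear_coord] linear_cmul[OF linear_coord]
  linear_neg[OF linear_coord] linear_0[OF linear_coord]

lemma decompose: "X = emb (coord X) + \<eta> X *\<^sub>R \<xi>"
  using adapted_frame_expansion[OF dim_5 frame, of X] by (simp add: emb_def coord_def)

lemma emb_axis: "emb (axis i 1) = e i"
  using exhaust_4[of i] by (auto simp: emb_def sum_4 axis4_nth)

lemma coord_emb: "coord (emb x) = x"
  by (simp add: coord_def emb_def vec_eq_iff forall_4 sum_4 g_simps ge)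

lemma coord_xi: "coord \<xi> = 0"
  by (simp add: coord_def vec_eq_iff g_xi eta_e)

lemma eta_emb: "\<eta> (emb x) = 0"
  by (simp add: emb_def sum_4 eta_simps eta_e)

text \<open>In the frame \<phi> is left multiplication by i; moving it to the first argument, as in
  \<open>qform\<close>, costs a sign.\<close>

lemma g_phi_emb: "g (emb x) (\<phi> (emb y)) = - qform 2 x y"
  by (simp add: emb_def sum_4 phi_simps phi_e g_simps ge qform_simps algebra_simps)

lemma br_emb: "br (emb x) (emb y) = emb (trans_br x y) + (2 * qform 2 x y) *\<^sub>R \<xi>"
  using decompose[of "br (emb x) (emb y)"] by (simp add: trans_br_def eta_br g_phi_emb)

lemma br_xi: "br \<xi> (emb x) = emb (reeb x)" "br (emb x) \<xi> = - emb (reeb x)"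
proof -
  have "\<eta> (br \<xi> (emb x)) = 0"
    by (simp add: eta_br g_xi eta_phi)
  then show "br \<xi> (emb x) = emb (reeb x)"
    using decompose[of "br \<xi> (emb x)"] by (simp add: reeb_def)
  then show "br (emb x) \<xi> = - emb (reeb x)"
    using br_skew[of "emb x" \<xi>] by simp
qed

lemma linear_reeb: "linear reeb"
  by (rule linearI) (simp_all add: reeb_def emb_simps br_simps coord_simps)

lemma bilinear_trans_br: "bilinear trans_br"
  unfolding bilinear_def
  by (auto intro!: linearI simp: trans_br_def emb_simps br_simps coord_simps)

lemma trans_br_alternating: "trans_br x x = 0"
  by (simp add: trans_br_def br_alternating coord_simps)

lemma trans_br_skew: "trans_br x y = - trans_br y x"
  using br_skew[of "emb x" "emb y"] by (simp add: trans_br_def coord_simps)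

text \<open>The (2,0)-forms on a complex plane form a complex line, here spanned by
  \<open>qform 3\<close> + \<i> \<open>qform 4\<close>.\<close>

lemma eps_emb:
  obtains l where "l \<noteq> 0" "\<And>x y. \<epsilon> (emb x) (emb y) = l * Complex (qform 3 x y) (qform 4 x y)"
proof
  define l where "l = \<epsilon> (e 1) (e 3)"
  have type: "\<epsilon> (\<phi> X) Y = \<i> * \<epsilon> X Y" if "\<eta> X = 0" "\<eta> Y = 0" for X Y
  proof -
    have "\<i> * (\<epsilon> X Y + \<i> * \<epsilon> (\<phi> X) Y) = 0"
      using eps_type that by (simp add: type_2_0_def)
    then show ?thesis
      by (simp add: algebra_simps)
  qed
  have 12: "\<epsilon> (e 1) (e 2) = 0" "\<epsilon> (e 3) (e 4) = 0"
    using type[of "e 1" "e 1"] type[of "e 3" "e 3"] eps_skew[of "e 1" "e 2"] eps_skew[of "e 3" "e 4"]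
    by (simp_all add: phi_e eta_e eps_alternating)
  have 23: "\<epsilon> (e 2) (e 3) = \<i> * l" "\<epsilon> (e 1) (e 4) = \<i> * l"
    using type[of "e 1" "e 3"] type[of "e 3" "e 1"] eps_skew[of "e 1" "e 4"] eps_skew[of "e 3" "e 1"]
    by (simp_all add: phi_e eta_e l_def)
  have 24: "\<epsilon> (e 2) (e 4) = - l"
    using type[of "e 1" "e 4"] by (simp add: phi_e eta_e 23)
  note vals = 12 23 24 l_def[symmetric]
  have "bilinear (\<lambda>x y. \<epsilon> (emb x) (emb y))"
    unfolding bilinear_def by (auto intro!: linearI simp: emb_simps eps_simps)
  moreover have "bilinear (\<lambda>x y. l * Complex (qform 3 x y) (qform 4 x y))"
    unfolding bilinear_def
    by (auto intro!: linearI simp: complex_eq_iff qform_simps algebra_simps)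
  moreover have "\<forall>i j. \<epsilon> (emb (axis i 1)) (emb (axis j 1))
    = l * Complex (qform 3 (axis i 1) (axis j 1)) (qform 4 (axis i 1) (axis j 1))"
    by (simp add: forall_4 emb_axis vals eps_alternating qform_simps axis4_nth complex_eq_iff
        eps_skew[of "e 2" "e 1"] eps_skew[of "e 3" "e 1"] eps_skew[of "e 4" "e 1"]
        eps_skew[of "e 3" "e 2"] eps_skew[of "e 4" "e 2"] eps_skew[of "e 4" "e 3"])
  ultimately have "(\<lambda>x y. \<epsilon> (emb x) (emb y)) = (\<lambda>x y. l * Complex (qform 3 x y) (qform 4 x y))"
    by (intro bilinear_eq_on_axes) auto
  then show eps: "\<epsilon> (emb x) (emb y) = l * Complex (qform 3 x y) (qform 4 x y)" for x y
    by meson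
  obtain X Y where XY: "\<eta> X = 0" "\<eta> Y = 0" "\<epsilon> X Y \<noteq> 0"
    using eps_nonvanishing by blast
  then have "X = emb (coord X)" "Y = emb (coord Y)"
    using decompose[of X] decompose[of Y] by simp_all
  then have "\<epsilon> X Y = l * Complex (qform 3 (coord X) (coord Y)) (qform 4 (coord X) (coord Y))"
    using eps by metis
  then show "l \<noteq> 0"
    using XY by auto
qed

text \<open>The ker \<eta> and \<xi> components of the Jacobi identity of \<open>br\<close>; the
  second one is d(d\<eta>) = 0.\<close>

lemma jacobi_emb:
  "trans_br x (trans_br y z) + trans_br y (trans_br z x) + trans_br z (trans_br x y)
    = 2 *\<^sub>R (qform 2 y z *\<^sub>R reeb x + qform 2 z x *\<^sub>R reeb y + qform 2 x y *\<^sub>R reeb z)"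
  "qform 2 x (trans_br y z) + qform 2 y (trans_br z x) + qform 2 z (trans_br x y) = 0"
proof -
  note J = br_jacobi[of "emb x" "emb y" "emb z"]
  have "coord (br (emb x) (br (emb y) (emb z)) + br (emb y) (br (emb z) (emb x))
      + br (emb z) (br (emb x) (emb y))) = 0"
    by (simp add: J coord_simps)
  then show "trans_br x (trans_br y z) + trans_br y (trans_br z x) + trans_br z (trans_br x y)
    = 2 *\<^sub>R (qform 2 y z *\<^sub>R reeb x + qform 2 z x *\<^sub>R reeb y + qform 2 x y *\<^sub>R reeb z)"
    by (simp add: br_emb br_simps br_xi coord_simps coord_emb coord_xi algebra_simps)
  have "\<eta> (br (emb x) (br (emb y) (emb z)) + br (emb y) (br (emb z) (emb x))
      + br (emb z) (br (emb x) (emb y))) = 0"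
    by (simp add: J eta_simps)
  then show "qform 2 x (trans_br y z) + qform 2 y (trans_br z x) + qform 2 z (trans_br x y) = 0"
    by (simp add: br_emb br_simps br_xi eta_simps eta_emb eta_xi)
qed

text \<open>The same splitting with one argument \<xi>: ad \<xi> is a derivation and preserves
  d\<eta>.\<close>

lemma jacobi_xi:
  "reeb (trans_br x y) = trans_br (reeb x) y + trans_br x (reeb y)"
  "qform 2 (reeb x) y + qform 2 x (reeb y) = 0"
proof -
  note J = br_jacobi[of \<xi> "emb x" "emb y"]
  have "coord (br \<xi> (br (emb x) (emb y)) + br (emb x) (br (emb y) \<xi>) + br (emb y) (br \<xi> (emb x))) = 0"
    by (simp add: J coord_simps)
  then show "reeb (trans_br x y) = trans_br (reeb x) y + trans_br x (reeb y)"
    using trans_br_skew[of y "reeb x"]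
    by (simp add: br_emb br_simps br_xi br_alternating coord_simps coord_emb coord_xi algebra_simps)
  have "\<eta> (br \<xi> (br (emb x) (emb y)) + br (emb x) (br (emb y) \<xi>) + br (emb y) (br \<xi> (emb x))) = 0"
    by (simp add: J eta_simps)
  then show "qform 2 (reeb x) y + qform 2 x (reeb y) = 0"
    by (simp add: br_emb br_simps br_xi br_alternating eta_simps eta_emb eta_xi)
      (simp add: qform_simps algebra_simps)
qed

text \<open>For \<open>k = 2\<close> this is d(d\<eta>) = 0. The other two forms come from
  d\<epsilon> = 0, where the \<xi>-components of brackets drop out because \<epsilon> is
  basic.\<close>

lemma qform_closed:
  assumes "k \<in> {2,3,4}"
  shows "ce_diff2 trans_br (qform k) x y z = 0"
proof -
  obtain l where l: "l \<noteq> 0" "\<And>x y. \<epsilon> (emb x) (emb y) = l * Complex (qform 3 x y) (qform 4 x y)"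
    using eps_emb by blast
  have "l * Complex (ce_diff2 trans_br (qform 3) x y z) (ce_diff2 trans_br (qform 4) x y z)
    = ce_diff2 br \<epsilon> (emb x) (emb y) (emb z)"
    by (simp add: ce_diff2_def br_emb eps_simps eps_xi l(2) complex_eq_iff algebra_simps)
  then have "Complex (ce_diff2 trans_br (qform 3) x y z) (ce_diff2 trans_br (qform 4) x y z) = 0"
    using l(1) by (simp add: eps_closed)
  then have 34: "ce_diff2 trans_br (qform 3) x y z = 0" "ce_diff2 trans_br (qform 4) x y z = 0"
    by (simp_all add: complex_eq_iff)
  have "ce_diff2 trans_br (qform 2) x y z = 0"
    using jacobi_emb(2)[of x y z] trans_br_skew[of z x]
    unfolding ce_diff2_def qform_simps by (simp add: algebra_simps)
  with 34 assms show ?thesis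
    by auto
qed

lemma qform_reeb_skew:
  assumes "k \<in> {2,3,4}"
  shows "qform k (reeb x) y + qform k x (reeb y) = 0"
proof -
  obtain l where l: "l \<noteq> 0" "\<And>x y. \<epsilon> (emb x) (emb y) = l * Complex (qform 3 x y) (qform 4 x y)"
    using eps_emb by blast
  have "l * Complex (qform 3 (reeb x) y + qform 3 x (reeb y)) (qform 4 (reeb x) y + qform 4 x (reeb y))
    = - lie_deriv2 br \<xi> \<epsilon> (emb x) (emb y)"
    by (simp add: lie_deriv2_def br_xi l(2) complex_eq_iff algebra_simps)
  then have "Complex (qform 3 (reeb x) y + qform 3 x (reeb y))
    (qform 4 (reeb x) y + qform 4 x (reeb y)) = 0"
    using l(1) eps_basic by (simp add: basic2_def)
  then have "qform 3 (reeb x) y + qform 3 x (reeb y) = 0" "qform 4 (reeb x) y + qform 4 x (reeb y) = 0"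
    by (simp_all add: complex_eq_iff)
  with jacobi_xi(2) assms show ?thesis
    by auto
qed

lemma reeb_zero: "reeb x = 0"
  by (rule reeb_action_zero[OF bilinear_trans_br trans_br_alternating linear_reeb qform_reeb_skew
        jacobi_xi(1) jacobi_emb(1)])

lemma trans_br_zero: "trans_br x y = 0"
  by (rule hyperkaehler_abelian[OF bilinear_trans_br trans_br_alternating qform_closed])
    (simp_all add: jacobi_emb(1) reeb_zero)

lemma br_eq: "br X Y = (2 * qform 2 (coord X) (coord Y)) *\<^sub>R \<xi>"
proof -
  have "br X Y = br (emb (coord X) + \<eta> X *\<^sub>R \<xi>) (emb (coord Y) + \<eta> Y *\<^sub>R \<xi>)"
    using decompose by metis
  then show ?thesis
    by (simp add: br_simps br_emb br_xi trans_br_zero reeb_zero emb_simps br_alternating)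
qed

lemma isomorphic_h5: "lie_isomorphic br h5"
proof -
  \<comment> \<open>The factor -1/2 matches the coefficient 2 of \<xi> in \<open>br_eq\<close> with
    the coefficient -1 of the last basis vector in \<open>h5\<close>.\<close>
  define f :: "'a \<Rightarrow> real^5" where
    "f X = vector [coord X $ 1, coord X $ 2, coord X $ 3, coord X $ 4, - \<eta> X / 2]" for X
  have all5: "(\<forall>i::5. P i) \<longleftrightarrow> P 1 \<and> P 2 \<and> P 3 \<and> P 4 \<and> P 5" for P
  proof -
    have "UNIV = {1, 2, 3, 4, 5 :: 5}"
      by (rule card_subset_eq[symmetric]) auto
    then show ?thesis
      by (metis UNIV_I insert_iff empty_iff)
  qed
  have f: "f X $ 1 = coord X $ 1" "f X $ 2 = coord X $ 2" "f X $ 3 = coord X $ 3"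
    "f X $ 4 = coord X $ 4" "f X $ 5 = - \<eta> X / 2" for X
    by (simp_all add: f_def vector_def)
  have lin: "linear f"
    by (rule linearI) (simp_all add: vec_eq_iff all5 f coord_simps eta_simps)
  define h where "h y = emb (vector [y$1, y$2, y$3, y$4]) - (2 * y$5) *\<^sub>R \<xi>" for y :: "real^5"
  have v: "(vector [a,b,c,d] :: real^4) $ 1 = a" "(vector [a,b,c,d] :: real^4) $ 2 = b"
    "(vector [a,b,c,d] :: real^4) $ 3 = c" "(vector [a,b,c,d] :: real^4) $ 4 = d" for a b c d
    by (simp_all add: vector_def)
  have "f (h y) = y" for y
    by (simp add: vec_eq_iff all5 f h_def coord_simps coord_emb coord_xi eta_simps eta_emb
        eta_xi v)
  moreover have "h (f X) = X" for X
  proof -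
    have "vector [coord X $ 1, coord X $ 2, coord X $ 3, coord X $ 4] = coord X"
      by (simp add: vec_eq_iff forall_4 v)
    then show ?thesis
      using decompose[of X] by (simp add: h_def f)
  qed
  ultimately have "bij f"
    by (metis bijI')
  moreover have "f (br X Y) = h5 (f X) (f Y)" for X Y
    by (simp add: vec_eq_iff all5 f br_eq coord_simps eta_simps coord_xi eta_xi h5_def qform_simps axis_def)
  ultimately show ?thesis
    using lin by (auto simp: lie_isomorphic_def)
qed

end

end

theorem lemma2p2:
  fixes br :: "'a::real_vector \<Rightarrow> 'a \<Rightarrow> 'a"
  assumes "contact_calabi_yau br"
  shows "lie_isomorphic br h5"
proof -
  obtain \<phi> \<xi> \<eta> g \<epsilon> where "contact_calabi_yau_structure br \<phi> \<xi> \<eta> g \<epsilon>"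
    using assms by (auto simp: contact_calabi_yau_def)
  then interpret contact_calabi_yau_structure br \<phi> \<xi> \<eta> g \<epsilon> .
  obtain e where "adapted_frame e"
    using adapted_frame_exists[OF dim_5] .
  then show ?thesis
    by (rule isomorphic_h5)
qed

end
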